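(* Let $n\in\mathbb N$, $n\ge1$, and $s\in(0,n)$. Assume that $A$ is a Young function satisfying $$\int_0\Big(\frac{t}{A(t)}\Big)^{\frac{s}{n-s}}\,dt<\infty$$ (convergence of the integral near $0$), and let $A_{\frac ns}$ be the Young function defined by $A_{\frac ns}(t)=A(H^{-1}(t))$ for $t\ge0$, where $$H(t)=\bigg(\int_0^t\Big(\frac{\tau}{A(\tau)}\Big)^{\frac{s}{n-s}}\,d\tau\bigg)^{\frac{n-s}{n}}\quad\text{for }t\ge0 .$$ Then there exists a constant $c=c(n,s)$, depending only on $n$ and $s$, such that $$\|u*v\|_{L^{A_{\frac ns}}(\mathbb R^n)}\le c\,\|v\|_{L^{\frac n{n-s}}(\mathbb R^n)}\|u\|_{L^A(\mathbb R^n)}$$ for every $u\in L^A(\mathbb R^n)$ and $v\in L^{\frac n{n-s}}(\mathbb R^n)$. Moreover, $$\int_{\mathbb R^n}A_{\frac ns}\Bigg(\frac{|u*v|}{c\,\|v\|_{L^{\frac n{n-s}}(\mathbb R^n)}\big(\int_{\mathbb R^n}A(|u|)\,dy\big)^{s/n}}\Bigg)dx\le\int_{\mathbb R^n}A(|u|)\,dx$$ for all such $u$ and $v$.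
   Context: A Young function is a function $A:[0,\infty)\to[0,\infty]$ that is convex, left-continuous, vanishes at $0$, and is neither identically $0$ nor identically $\infty$ (on $(0,\infty)$). One sets $A(\infty)=\infty$, and $t/A(t)=0$ where $A(t)=\infty$. $H^{-1}$ is the generalized left-continuous inverse of $H$: it is the classical inverse if $\int^\infty(t/A(t))^{\frac s{n-s}}dt=\infty$; if instead this integral converges at infinity, then $H^{-1}(t)=\infty$, and hence $A_{\frac ns}(t)=\infty$, for $t>t_\infty$, where $t_\infty=\big(\int_0^\infty(t/A(t))^{\frac s{n-s}}dt\big)^{\frac{n-s}n}$. The Luxemburg norm of a real-valued measurable function $u$ on $\mathbb R^n$ is $\|u\|_{L^A(\mathbb R^n)}=\inf\{\lambda>0:\int_{\mathbb R^n}A(|u(x)|/\lambda)\,dx\le1\}$, and $L^A(\mathbb R^n)$ is the set of such functions with finite norm. $u*v$ denotes convolution on $\mathbb R^n$. In the integral inequality, the quotient is read as $0$ when $u=0$ or $v=0$ a.e., and the inequality is trivial when $\int_{\mathbb R^n}A(|u|)\,dx=\infty$. *)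

theory Defs
  imports "HOL-Analysis.Analysis"
begin

text \<open>
  Functions from \<open>[0, \<infinity>)\<close> to \<open>[0, \<infinity>]\<close>, extended by the value \<open>\<infinity>\<close> at \<open>\<infinity>\<close>, have type
  \<^typ>\<open>ennreal \<Rightarrow> ennreal\<close>. In \<^typ>\<open>ennreal\<close>, \<open>x / \<infinity> = 0\<close> for \<open>x < \<infinity>\<close>, \<open>x / 0 = \<infinity>\<close> for \<open>x > 0\<close>,
  and \<open>0 / 0 = 0\<close>.
\<close>

definition young_function :: "(ennreal \<Rightarrow> ennreal) \<Rightarrow> bool" where
  "young_function A \<longleftrightarrow>
     A 0 = 0 \<and> A \<infinity> = \<infinity> \<and>
     (\<forall>x y l :: real. 0 \<le> x \<longrightarrow> 0 \<le> y \<longrightarrow> 0 \<le> l \<longrightarrow> l \<le> 1 \<longrightarrow>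
        A (ennreal (l * x + (1 - l) * y))
          \<le> ennreal l * A (ennreal x) + ennreal (1 - l) * A (ennreal y)) \<and>
     (\<forall>t :: real. 0 < t \<longrightarrow> continuous (at_left t) (\<lambda>r. A (ennreal r))) \<and>
     (\<exists>t :: real. 0 < t \<and> A (ennreal t) \<noteq> 0) \<and>
     (\<exists>t :: real. 0 < t \<and> A (ennreal t) \<noteq> \<infinity>)"

text \<open>Only used for exponents \<open>p > 0\<close>, where \<open>\<infinity>\<close> is mapped to \<open>\<infinity>\<close>.\<close>

definition ennpowr :: "ennreal \<Rightarrow> real \<Rightarrow> ennreal" where
  "ennpowr x p = (if x = \<infinity> then \<infinity> else ennreal (enn2real x powr p))"

definition modular :: "(ennreal \<Rightarrow> ennreal) \<Rightarrow> ('a::euclidean_space \<Rightarrow> real) \<Rightarrow> ennreal" where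
  "modular A u = (\<integral>\<^sup>+x. A (ennreal \<bar>u x\<bar>) \<partial>lebesgue)"

text \<open>The infimum is taken in \<^typ>\<open>ennreal\<close>, so it is \<open>\<infinity>\<close> when no \<open>l\<close> is admissible.\<close>

definition luxemburg_norm :: "(ennreal \<Rightarrow> ennreal) \<Rightarrow> ('a::euclidean_space \<Rightarrow> real) \<Rightarrow> ennreal" where
  "luxemburg_norm A u = (INF l\<in>{l::real. 0 < l \<and> modular A (\<lambda>x. u x / l) \<le> 1}. ennreal l)"

definition orlicz_space :: "(ennreal \<Rightarrow> ennreal) \<Rightarrow> ('a::euclidean_space \<Rightarrow> real) set" where
  "orlicz_space A = {u \<in> borel_measurable lebesgue. luxemburg_norm A u < \<infinity>}"

definition Lp_norm :: "real \<Rightarrow> ('a::euclidean_space \<Rightarrow> real) \<Rightarrow> ennreal" where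
  "Lp_norm p v = ennpowr (\<integral>\<^sup>+x. ennreal (\<bar>v x\<bar> powr p) \<partial>lebesgue) (1 / p)"

definition Lp_space :: "real \<Rightarrow> ('a::euclidean_space \<Rightarrow> real) set" where
  "Lp_space p = {v \<in> borel_measurable lebesgue. Lp_norm p v < \<infinity>}"

text \<open>The Bochner integral is \<open>0\<close> at points where the integrand is not integrable.\<close>

definition conv :: "('a::euclidean_space \<Rightarrow> real) \<Rightarrow> ('a \<Rightarrow> real) \<Rightarrow> 'a \<Rightarrow> real" where
  "conv u v x = (\<integral>y. u (x - y) * v y \<partial>lebesgue)"

definition young_H :: "nat \<Rightarrow> real \<Rightarrow> (ennreal \<Rightarrow> ennreal) \<Rightarrow> real \<Rightarrow> ennreal" where
  "young_H n s A t =
     ennpowr (\<integral>\<^sup>+\<tau>\<in>{0..t}. ennpowr (ennreal \<tau> / A (ennreal \<tau>)) (s / (real n - s)) \<partial>lborel)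
       ((real n - s) / real n)"

text \<open>Generalized left-continuous inverse; it is \<open>\<infinity>\<close> (the infimum of the empty set) above the
  range of \<^const>\<open>young_H\<close>.\<close>

definition young_H_inv :: "nat \<Rightarrow> real \<Rightarrow> (ennreal \<Rightarrow> ennreal) \<Rightarrow> ennreal \<Rightarrow> ennreal" where
  "young_H_inv n s A t = (INF r\<in>{r::real. 0 \<le> r \<and> t \<le> young_H n s A r}. ennreal r)"

definition sobolev_young :: "nat \<Rightarrow> real \<Rightarrow> (ennreal \<Rightarrow> ennreal) \<Rightarrow> ennreal \<Rightarrow> ennreal" where
  "sobolev_young n s A t = A (young_H_inv n s A t)"

definition integral_near_0_finite :: "nat \<Rightarrow> real \<Rightarrow> (ennreal \<Rightarrow> ennreal) \<Rightarrow> bool" where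
  "integral_near_0_finite n s A \<longleftrightarrow>
     (\<exists>e::real. 0 < e \<and>
        (\<integral>\<^sup>+t\<in>{0<..<e}. ennpowr (ennreal t / A (ennreal t)) (s / (real n - s)) \<partial>lborel) < \<infinity>)"

end

theory Submission
  imports Defs
begin

text \<open>
  Write \<open>\<theta> = s / n\<close> and \<open>q = n / (n - s)\<close>, so that \<open>q (1 - \<theta>) = 1\<close>. The estimate follows from a pointwise
  inequality, much as Young's convolution inequality does, and the constant is \<open>c = 2\<close>.

  Let \<open>\<parallel>v\<parallel>\<^sub>q \<le> 1\<close> and \<open>\<integral> A(\<bar>u\<bar>) \<le> m\<close>, and put \<open>G(x) = \<integral> A(\<bar>u(x - y)\<bar>) \<bar>v y\<bar>\<^sup>q dy\<close>. By Tonelli,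
  \<open>\<integral> G \<le> \<integral> A(\<bar>u\<bar>)\<close>, so it suffices to show that
  \<open>A(H\<^sup>-\<^sup>1(\<bar>u * v\<bar>(x) / (2 m powr \<theta>))) \<le> G(x)\<close> for almost every \<open>x\<close>. Fix \<open>x\<close> with \<open>G(x)\<close> finite and positive
  and let \<open>t\<close> be the largest number with \<open>A(t) \<le> G(x)\<close>. Since \<open>H\<^sup>-\<^sup>1(H(t)) \<le> t\<close>, it is enough that
  \<open>\<integral> \<bar>u(x - y)\<bar> \<bar>v y\<bar> dy \<le> 2 (m powr \<theta>) H(t)\<close>. Split the integral according to the size of \<open>f = \<bar>u(x - y)\<bar>\<close>.

  \<^item> Because \<open>\<tau> / A(\<tau>)\<close> is nonincreasing, \<open>r \<le> A(r) powr \<theta> * H(r)\<close> for all \<open>r\<close> with \<open>A(r)\<close> finite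
    (\<open>young_H_ge\<close>). Where \<open>f \<le> t\<close> this gives \<open>f \<le> A(f) powr \<theta> * H(t)\<close>, and Hoelder's inequality with the
    exponents \<open>1 / \<theta>\<close> and \<open>q\<close> bounds this part by \<open>(m powr \<theta>) H(t)\<close>.

  \<^item> Where \<open>f > t\<close>, the choice of \<open>t\<close> gives \<open>f \<le> (t / G(x)) A(f)\<close> (\<open>young_level\<close>). Writing
    \<open>A(f) \<bar>v\<bar> = A(f) powr \<theta> * (A(f) \<bar>v\<bar>\<^sup>q) powr (1 - \<theta>)\<close>, Hoelder's inequality bounds this part by
    \<open>(m powr \<theta>) t G(x) powr (- \<theta>)\<close>, which is at most \<open>(m powr \<theta>) H(t)\<close> by \<open>A(t) \<le> G(x)\<close> and the first item
    at \<open>r = t\<close>.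

  These two bounds are combined in \<open>integral_product_le_young_H\<close>. Taking \<open>m = \<integral> A(\<bar>u\<bar>)\<close> gives the modular
  inequality; applying the estimate to \<open>u / \<lambda>\<close> with \<open>\<integral> A(\<bar>u\<bar> / \<lambda>) \<le> 1\<close> and \<open>m = 1\<close> gives the norm
  inequality.
\<close>

section \<open>Monotone functions of extended nonnegative reals\<close>

text \<open>
  This makes Young functions and powers measurable. The set \<open>{x. y < f x}\<close> is an upper set, hence a ray that is closed or open according to whether it contains
  its infimum.
\<close>

lemma borel_measurable_mono_ennreal:
  fixes f :: "ennreal \<Rightarrow> ennreal"
  assumes "mono f"
  shows "f \<in> borel_measurable borel"
proof (rule borel_measurableI_greater)
  fix y
  let ?U = "{x \<in> space borel. y < f x}"
  have up: "x' \<in> ?U" if "x \<in> ?U" "x \<le> x'" for x x'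
    using that monoD[OF assms, of x x'] by auto
  have "?U = {Inf ?U..} \<or> ?U = {Inf ?U<..}"
  proof (cases "Inf ?U \<in> ?U")
    case True
    have "?U = {Inf ?U..}"
      using up[OF True] Inf_lower[of _ ?U] by blast
    then show ?thesis by blast
  next
    case False
    have "x \<in> ?U \<longleftrightarrow> Inf ?U < x" for x
    proof
      assume "x \<in> ?U"
      with False show "Inf ?U < x"
        by (metis Inf_lower order_le_imp_less_or_eq)
    next
      assume "Inf ?U < x"
      then obtain x' where "x' \<in> ?U" "x' < x"
        unfolding Inf_less_iff by blast
      then show "x \<in> ?U" using up[of x' x] by auto
    qed
    then have "?U = {Inf ?U<..}" by blast
    then show ?thesis by blast
  qed
  then show "?U \<in> sets borel"
  proof
    assume U: "?U = {Inf ?U..}"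
    show ?thesis by (subst U) (rule atLeast_borel)
  next
    assume U: "?U = {Inf ?U<..}"
    show ?thesis by (subst U) (rule greaterThan_borel)
  qed
qed

lemma ennpowr_mono: "0 \<le> p \<Longrightarrow> mono (\<lambda>x. ennpowr x p)"
  by (rule monoI) (auto simp: ennpowr_def top_unique less_top[symmetric] enn2real_mono intro!: ennreal_leI powr_mono2)

lemma ennpowr_ennreal: "0 \<le> x \<Longrightarrow> ennpowr (ennreal x) p = ennreal (x powr p)"
  by (simp add: ennpowr_def)

section \<open>Young functions\<close>

lemma young_scale:
  assumes A: "young_function A" and "0 \<le> l" "l \<le> 1" "0 \<le> x"
  shows "A (ennreal (l * x)) \<le> ennreal l * A (ennreal x)"
proof -
  have "A (ennreal (l * x + (1 - l) * 0))
      \<le> ennreal l * A (ennreal x) + ennreal (1 - l) * A (ennreal 0)"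
    using assms unfolding young_function_def by (metis order_refl)
  with A show ?thesis by (simp add: young_function_def)
qed

text \<open>
  Convexity and \<open>A 0 = 0\<close> make \<open>A(\<tau>) / \<tau>\<close> nondecreasing; the product form avoids division by
  \<open>0\<close> and \<open>\<infinity>\<close>.
\<close>

lemma young_ratio:
  assumes A: "young_function A" and "0 \<le> r" "r \<le> t"
  shows "ennreal t * A (ennreal r) \<le> ennreal r * A (ennreal t)"
proof (cases "t = 0")
  case True
  with assms show ?thesis by simp
next
  case False
  then have t: "0 < t" using assms by simp
  have "A (ennreal (r / t * t)) \<le> ennreal (r / t) * A (ennreal t)"
    using assms t by (intro young_scale) auto
  then have "ennreal t * A (ennreal r) \<le> ennreal t * (ennreal (r / t) * A (ennreal t))"
    using t by (intro mult_left_mono) auto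
  also have "\<dots> = ennreal r * A (ennreal t)"
    using t assms by (simp add: mult.assoc[symmetric] ennreal_mult[symmetric])
  finally show ?thesis .
qed

lemma young_mono:
  assumes A: "young_function A"
  shows "mono A"
proof (rule monoI)
  fix x y :: ennreal
  assume xy: "x \<le> y"
  show "A x \<le> A y"
  proof (cases "y = \<infinity>")
    case True
    with A show ?thesis by (simp add: young_function_def)
  next
    case False
    then obtain a where a: "0 \<le> a" "y = ennreal a" by (cases y) auto
    with xy obtain b where b: "0 \<le> b" "b \<le> a" "x = ennreal b"
      by (cases x) (auto simp: top_unique)
    show ?thesis
    proof (cases "a = 0")
      case True
      with a b show ?thesis by simp
    next
      case nz: False
      have "A (ennreal (b / a * a)) \<le> ennreal (b / a) * A (ennreal a)"
        using a b nz by (intro young_scale A) auto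
      also have "\<dots> \<le> 1 * A (ennreal a)"
        using a b nz by (intro mult_right_mono) auto
      finally show ?thesis using a b nz by simp
    qed
  qed
qed

lemma young_measurable:
  assumes "young_function A"
  shows "A \<in> borel_measurable borel"
  using borel_measurable_mono_ennreal[OF young_mono[OF assms]] .

text \<open>
  If \<open>A\<close> vanished at some \<open>t > 0\<close>, it would vanish on \<open>[0, t]\<close>, where \<open>\<tau> / A(\<tau>) = \<infinity>\<close>, contradicting the
  convergence of the integral near \<open>0\<close>.
\<close>

lemma young_pos:
  assumes A: "young_function A" and i0: "integral_near_0_finite n s A"
    and s: "0 < s" "s < real n" and t: "0 < t"
  shows "0 < A (ennreal t)"
proof (rule ccontr)
  assume "\<not> 0 < A (ennreal t)"
  then have At: "A (ennreal t) = 0" by (simp add: zero_less_iff_neq_zero)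
  obtain e where e: "0 < e"
    and fin: "(\<integral>\<^sup>+t\<in>{0<..<e}. ennpowr (ennreal t / A (ennreal t)) (s / (real n - s)) \<partial>lborel) < \<infinity>"
    using i0 unfolding integral_near_0_finite_def by blast
  define d where "d = min e t"
  have d: "0 < d" "d \<le> e" "d \<le> t" using e t by (auto simp: d_def)
  have "\<infinity> = (\<integral>\<^sup>+r. \<infinity> * indicator {0<..<d} r \<partial>(lborel :: real measure))"
    using d by (subst nn_integral_cmult_indicator) (auto simp: ennreal_top_mult)
  also have "\<dots> \<le> (\<integral>\<^sup>+t\<in>{0<..<e}. ennpowr (ennreal t / A (ennreal t)) (s / (real n - s)) \<partial>lborel)"
  proof (rule nn_integral_mono)
    fix r :: real
    show "\<infinity> * indicator {0<..<d} r
      \<le> ennpowr (ennreal r / A (ennreal r)) (s / (real n - s)) * indicator {0<..<e} r"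
    proof (cases "r \<in> {0<..<d}")
      case True
      then have "A (ennreal r) \<le> A (ennreal t)"
        using d by (intro monoD[OF young_mono[OF A]] ennreal_leI) auto
      with At True d show ?thesis by (simp add: ennpowr_def)
    qed simp
  qed
  finally show False using fin by (simp add: top_unique)
qed

lemma young_quotient_antimono:
  assumes A: "young_function A" and "0 < r" "r \<le> t"
  shows "ennreal t / A (ennreal t) \<le> ennreal r / A (ennreal r)"
proof -
  consider "A (ennreal t) = \<infinity>" | "A (ennreal r) = 0"
    | a b where "0 \<le> a" "A (ennreal t) = ennreal a" "0 < b" "A (ennreal r) = ennreal b"
    using monoD[OF young_mono[OF A] ennreal_leI[OF \<open>r \<le> t\<close>]]
    by (cases "A (ennreal t)"; cases "A (ennreal r)") (auto simp: top_unique, force)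
  then show ?thesis
  proof cases
    case 3
    have "t * b \<le> r * a"
      using young_ratio[OF A, of r t] assms 3 by (simp add: ennreal_mult[symmetric])
    moreover have "0 < t * b" using assms 3 by simp
    ultimately have "0 < a" using 3(1) by (cases "a = 0") auto
    with \<open>t * b \<le> r * a\<close> show ?thesis using assms 3 by (simp add: divide_ennreal field_simps)
  qed (use assms in auto)
qed

section \<open>The function H\<close>

lemma young_H_mono:
  assumes s: "0 < s" "s < real n" and "r \<le> t"
  shows "young_H n s A r \<le> young_H n s A t"
  unfolding young_H_def using assms
  by (intro monoD[OF ennpowr_mono] nn_integral_mono mult_left_mono)
     (auto simp: indicator_def)

text \<open>
  On \<open>[e / 2, t]\<close> the integrand is at most its value at \<open>e / 2\<close>, which is finite because \<open>A(e / 2) > 0\<close>.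
\<close>

lemma young_H_finite:
  assumes A: "young_function A" and i0: "integral_near_0_finite n s A"
    and s: "0 < s" "s < real n"
  shows "young_H n s A t < \<infinity>"
proof -
  let ?p = "s / (real n - s)"
  let ?f = "\<lambda>t. ennpowr (ennreal t / A (ennreal t)) ?p"
  have p: "0 \<le> ?p" using s by simp
  have [measurable]: "(\<lambda>x. ennpowr x ?p) \<in> borel_measurable borel" "A \<in> borel_measurable borel"
    using borel_measurable_mono_ennreal[OF ennpowr_mono[OF p]] young_measurable[OF A] .
  obtain e where e: "0 < e" and fin: "(\<integral>\<^sup>+t\<in>{0<..<e}. ?f t \<partial>lborel) < \<infinity>"
    using i0 unfolding integral_near_0_finite_def by blast
  have K: "?f (e / 2) < \<infinity>"
    using young_pos[OF A i0 s, of "e / 2"] e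
    by (auto simp: ennpowr_def ennreal_divide_eq_top_iff)
  have "(\<integral>\<^sup>+\<tau>\<in>{0..t}. ?f \<tau> \<partial>lborel)
     \<le> (\<integral>\<^sup>+\<tau>. ?f \<tau> * indicator {0<..<e} \<tau> + ?f (e / 2) * indicator {e / 2..t} \<tau> \<partial>lborel)"
  proof (rule nn_integral_mono)
    fix \<tau> :: real
    consider "\<tau> \<le> 0" | "0 < \<tau>" "\<tau> < e / 2" | "e / 2 \<le> \<tau>" by linarith
    then show "?f \<tau> * indicator {0..t} \<tau>
      \<le> ?f \<tau> * indicator {0<..<e} \<tau> + ?f (e / 2) * indicator {e / 2..t} \<tau>"
    proof cases
      case 1
      then show ?thesis by (auto simp: indicator_def ennpowr_def)
    next
      case 2
      then show ?thesis by (auto simp: indicator_def)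
    next
      case 3
      have "?f \<tau> \<le> ?f (e / 2)"
        using 3 e by (intro monoD[OF ennpowr_mono[OF p]] young_quotient_antimono A) auto
      with 3 e show ?thesis by (auto simp: indicator_def add_increasing)
    qed
  qed
  also have "\<dots> = (\<integral>\<^sup>+t\<in>{0<..<e}. ?f t \<partial>lborel) + ?f (e / 2) * emeasure lborel {e / 2..t}"
    by (subst nn_integral_add) (auto simp: nn_integral_cmult_indicator)
  also have "\<dots> < \<infinity>"
    using fin K emeasure_lborel_Icc_eq[of "e / 2" t]
    by (auto simp: ennreal_mult_less_top ennreal_mult_eq_top_iff less_top[symmetric])
  finally show ?thesis
    unfolding young_H_def ennpowr_def by auto
qed

text \<open>
  The integrand in \<open>H(t)\<close> is at least its value at the right endpoint, so \<open>H(t)\<close> is at least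
  \<open>(t (t / A(t)) powr (s / (n - s))) powr ((n - s) / n) = t A(t) powr (- s / n)\<close>.
\<close>

lemma young_H_ge:
  assumes A: "young_function A" and s: "0 < s" "s < real n"
    and i0: "integral_near_0_finite n s A"
    and t: "0 \<le> t" and a: "A (ennreal t) = ennreal a" "0 \<le> a"
  shows "ennreal t \<le> ennreal (a powr (s / real n)) * young_H n s A t"
proof (cases "t = 0")
  case True
  then show ?thesis by simp
next
  case False
  then have t: "0 < t" using t by simp
  have a0: "0 < a" using young_pos[OF A i0 s t] a by simp
  let ?p = "s / (real n - s)"
  let ?f = "\<lambda>t. ennpowr (ennreal t / A (ennreal t)) ?p"
  have p: "0 \<le> ?p" using s by simp
  have e: "(real n - s) / real n \<ge> 0" using s by simp
  have ft: "?f t = ennreal ((t / a) powr ?p)"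
    using t a0 a by (simp add: divide_ennreal ennpowr_ennreal)
  have "ennreal ((t / a) powr ?p * t) = (\<integral>\<^sup>+\<tau>. ?f t * indicator {0..t} \<tau> \<partial>lborel)"
    using t a0 by (subst nn_integral_cmult_indicator) (auto simp: ft ennreal_mult)
  also have "\<dots> = (\<integral>\<^sup>+\<tau>. ?f t * indicator {0<..t} \<tau> \<partial>lborel)"
    using t by (simp add: nn_integral_cmult_indicator)
  also have "\<dots> \<le> (\<integral>\<^sup>+\<tau>\<in>{0..t}. ?f \<tau> \<partial>lborel)"
    by (intro nn_integral_mono)
       (auto simp: indicator_def intro!: monoD[OF ennpowr_mono[OF p]] young_quotient_antimono A)
  finally have "ennpowr (ennreal ((t / a) powr ?p * t)) ((real n - s) / real n) \<le> young_H n s A t"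
    unfolding young_H_def by (intro monoD[OF ennpowr_mono[OF e]])
  moreover have "((t / a) powr ?p * t) powr ((real n - s) / real n) = t * a powr (- (s / real n))"
  proof -
    have "((t / a) powr ?p * t) powr ((real n - s) / real n)
        = exp ((?p * (ln t - ln a) + ln t) * ((real n - s) / real n))"
      using t a0 by (simp add: powr_def ln_mult ln_div field_simps)
    also have "(?p * (ln t - ln a) + ln t) * ((real n - s) / real n) = ln t - (s / real n) * ln a"
      using s by (simp add: field_simps)
    also have "exp (ln t - (s / real n) * ln a) = t * a powr (- (s / real n))"
      using t a0 by (simp add: powr_def exp_diff exp_minus divide_inverse)
    finally show ?thesis .
  qed
  ultimately have H: "ennreal (t * a powr (- (s / real n))) \<le> young_H n s A t"
    using t a0 by (simp add: ennpowr_ennreal)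
  have "ennreal t = ennreal (a powr (s / real n)) * ennreal (t * a powr (- (s / real n)))"
    using t a0 by (simp add: ennreal_mult[symmetric] powr_minus field_simps)
  also have "\<dots> \<le> ennreal (a powr (s / real n)) * young_H n s A t"
    by (intro mult_left_mono H) auto
  finally show ?thesis .
qed

text \<open>
  The largest \<open>t\<close> with \<open>A(t) \<le> G\<close> plays the role of \<open>A\<^sup>-\<^sup>1(G)\<close>. As \<open>A\<close> may jump to \<open>\<infinity>\<close> just above \<open>t\<close>,
  equality \<open>A(t) = G\<close> cannot be expected. Left continuity yields \<open>A(t) \<le> G\<close>, while for \<open>t < w < r\<close> the bound
  \<open>G \<le> A(w) \<le> (w / r) A(r)\<close> yields the second property in the limit \<open>w \<rightarrow> t\<close>.
\<close>

lemma young_level: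
  assumes A: "young_function A" and i0: "integral_near_0_finite n s A"
    and s: "0 < s" "s < real n" and G: "0 < G"
  obtains t where "0 \<le> t" "A (ennreal t) \<le> ennreal G"
    "\<And>r a. t < r \<Longrightarrow> A (ennreal r) = ennreal a \<Longrightarrow> 0 \<le> a \<Longrightarrow> G * r \<le> t * a"
proof -
  define S where "S = {t. 0 \<le> t \<and> A (ennreal t) \<le> ennreal G}"
  define t where "t = Sup S"
  have "0 \<in> S" using A by (simp add: S_def young_function_def)
  obtain b where b: "0 < b" "ennreal b \<le> A (ennreal 1)"
  proof (cases "A (ennreal 1)")
    case (real b)
    then show ?thesis using young_pos[OF A i0 s, of 1] that[of b] by auto
  next
    case top
    then show ?thesis using that[of 1] by auto
  qed
  \<comment> \<open>\<open>A\<close> grows at least linearly beyond \<open>1\<close>, so the set is bounded.\<close>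
  have "r \<le> max 1 (G / b)" if r: "r \<in> S" for r
  proof (cases "r \<le> 1")
    case False
    have "ennreal (r * b) \<le> ennreal r * A (ennreal 1)"
      using b False by (auto simp: ennreal_mult intro: mult_left_mono)
    also have "\<dots> \<le> 1 * A (ennreal r)"
      using young_ratio[OF A, of 1 r] False by simp
    also have "\<dots> \<le> ennreal G" using r by (simp add: S_def)
    finally have "r * b \<le> G" using G by (simp add: ennreal_le_iff)
    then have "r \<le> G / b" using b by (simp add: field_simps)
    then show ?thesis by simp
  qed simp
  then have bdd: "bdd_above S" by (auto simp: bdd_above_def)
  have t0: "0 \<le> t"
    unfolding t_def using \<open>0 \<in> S\<close> bdd by (rule cSup_upper)
  have below: "A (ennreal r) \<le> ennreal G" if "0 \<le> r" "r < t" for r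
  proof -
    from that obtain r' where "r' \<in> S" "r < r'"
      unfolding t_def using less_cSup_iff[OF _ bdd] \<open>0 \<in> S\<close> by auto
    then show ?thesis
      using monoD[OF young_mono[OF A] ennreal_leI, of r r'] by (auto simp: S_def)
  qed
  have At: "A (ennreal t) \<le> ennreal G"
  proof (cases "t = 0")
    case True
    with \<open>0 \<in> S\<close> show ?thesis by (simp add: S_def)
  next
    case False
    then have t: "0 < t" using t0 by simp
    then have "((\<lambda>r. A (ennreal r)) \<longlongrightarrow> A (ennreal t)) (at_left t)"
      using A by (auto simp: young_function_def continuous_within)
    moreover have "\<forall>\<^sub>F r in at_left t. A (ennreal r) \<le> ennreal G"
      using eventually_at_left_real[OF t] by eventually_elim (auto intro: below)
    ultimately show ?thesis
      by (rule tendsto_upperbound) simp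
  qed
  have "G * r \<le> t * a" if r: "t < r" and a: "A (ennreal r) = ennreal a" "0 \<le> a" for r a
  proof -
    have r0: "0 < r" using r t0 by simp
    then have a0: "0 < a" using young_pos[OF A i0 s, of r] a by simp
    have "G * r / a \<le> w" if w: "t < w" "w < r" for w
    proof -
      have "w \<notin> S" using w bdd cSup_upper[of w S] by (auto simp: t_def)
      then have "ennreal G \<le> A (ennreal w)" using w t0 by (auto simp: S_def)
      then have "ennreal (r * G) \<le> ennreal r * A (ennreal w)"
        using r0 G by (auto simp: ennreal_mult intro: mult_left_mono)
      also have "\<dots> \<le> ennreal w * A (ennreal r)"
        using w t0 by (intro young_ratio A) auto
      also have "\<dots> = ennreal (w * a)" using a w t0 by (simp add: ennreal_mult)
      finally have "r * G \<le> w * a" using a0 w t0 by (simp add: ennreal_le_iff)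
      then show ?thesis using a0 by (simp add: field_simps)
    qed
    then have "G * r / a \<le> t" by (rule dense_ge_bounded[OF r])
    then show ?thesis using a0 by (simp add: field_simps)
  qed
  with t0 At show ?thesis by (rule that)
qed

section \<open>The pointwise bound\<close>

text \<open>
  Hoelder's inequality with exponents \<open>1 / \<theta>\<close> and \<open>1 / (1 - \<theta>)\<close>, obtained by integrating the weighted
  arithmetic-geometric mean inequality for \<open>\<phi> / a\<close> and \<open>\<psi> / b\<close>.
\<close>

lemma nn_integral_geometric_mean_le:
  fixes \<phi> \<psi> :: "'a \<Rightarrow> real"
  assumes [measurable]: "\<phi> \<in> borel_measurable M" "\<psi> \<in> borel_measurable M"
    and nonneg: "\<And>x. 0 \<le> \<phi> x" "\<And>x. 0 \<le> \<psi> x"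
    and \<theta>: "0 < \<theta>" "\<theta> < 1" and ab: "0 < a" "0 < b"
    and le: "(\<integral>\<^sup>+x. ennreal (\<phi> x) \<partial>M) \<le> ennreal a" "(\<integral>\<^sup>+x. ennreal (\<psi> x) \<partial>M) \<le> ennreal b"
  shows "(\<integral>\<^sup>+x. ennreal (\<phi> x powr \<theta> * \<psi> x powr (1 - \<theta>)) \<partial>M)
    \<le> ennreal (a powr \<theta> * b powr (1 - \<theta>))"
proof -
  define c where "c = a powr \<theta> * b powr (1 - \<theta>)"
  have c: "0 < c" using ab by (simp add: c_def)
  have pt: "\<phi> x powr \<theta> * \<psi> x powr (1 - \<theta>) \<le> (c * \<theta> / a) * \<phi> x + (c * (1 - \<theta>) / b) * \<psi> x" for x
  proof (cases "\<phi> x = 0 \<or> \<psi> x = 0")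
    case True
    then show ?thesis using \<theta> ab c nonneg[of x] by auto
  next
    case False
    then have p: "0 < \<phi> x" "0 < \<psi> x" using nonneg[of x] by auto
    have "\<phi> x powr \<theta> * \<psi> x powr (1 - \<theta>)
        = c * ((\<phi> x / a) powr \<theta> * (\<psi> x / b) powr (1 - \<theta>))"
      using p ab by (simp add: c_def powr_divide)
    also have "\<dots> \<le> c * (\<theta> * (\<phi> x / a) + (1 - \<theta>) * (\<psi> x / b))"
      using p ab c \<theta> by (intro mult_left_mono Youngs_inequality_0) auto
    finally show ?thesis by (simp add: algebra_simps)
  qed
  have "(\<integral>\<^sup>+x. ennreal (\<phi> x powr \<theta> * \<psi> x powr (1 - \<theta>)) \<partial>M)
    \<le> (\<integral>\<^sup>+x. ennreal (c * \<theta> / a) * ennreal (\<phi> x) + ennreal (c * (1 - \<theta>) / b) * ennreal (\<psi> x) \<partial>M)"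
    using c \<theta> ab nonneg pt
    by (intro nn_integral_mono) (auto simp: ennreal_mult[symmetric] ennreal_plus[symmetric] simp del: ennreal_plus intro!: ennreal_leI)
  also have "\<dots> = ennreal (c * \<theta> / a) * (\<integral>\<^sup>+x. ennreal (\<phi> x) \<partial>M)
      + ennreal (c * (1 - \<theta>) / b) * (\<integral>\<^sup>+x. ennreal (\<psi> x) \<partial>M)"
    by (simp add: nn_integral_add nn_integral_cmult)
  also have "\<dots> \<le> ennreal (c * \<theta> / a) * ennreal a + ennreal (c * (1 - \<theta>) / b) * ennreal b"
    by (intro add_mono mult_left_mono le) auto
  also have "\<dots> = ennreal (c * \<theta> / a * a + c * (1 - \<theta>) / b * b)"
    using c \<theta> ab by (simp add: ennreal_mult[symmetric] ennreal_plus[symmetric] del: ennreal_plus)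
  also have "c * \<theta> / a * a + c * (1 - \<theta>) / b * b = c"
    using ab by (simp add: field_simps)
  finally show ?thesis by (simp add: c_def)
qed

text \<open>
  The heart of the proof, to be used with \<open>f y = \<bar>u (x - y)\<bar>\<close> and \<open>g = \<bar>v\<bar>\<close>: the integral of \<open>f g\<close> is
  controlled by \<open>H(t)\<close> at the level \<open>t\<close> at which \<open>A\<close> reaches the integral of \<open>A(f) g\<^sup>q\<close>.
\<close>

lemma integral_product_le_young_H:
  fixes f g :: "'a \<Rightarrow> real"
  assumes A: "young_function A" and i0: "integral_near_0_finite n s A"
    and s: "0 < s" "s < real n"
    and fg[measurable]: "f \<in> borel_measurable M" "g \<in> borel_measurable M"
    and nonneg: "\<And>y. 0 \<le> f y" "\<And>y. 0 \<le> g y"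
    and m: "0 < m" "(\<integral>\<^sup>+y. A (ennreal (f y)) \<partial>M) \<le> ennreal m"
    and g1: "(\<integral>\<^sup>+y. ennreal (g y powr (real n / (real n - s))) \<partial>M) \<le> 1"
    and Gfin: "(\<integral>\<^sup>+y. A (ennreal (f y)) * ennreal (g y powr (real n / (real n - s))) \<partial>M) < \<infinity>"
  obtains t where "0 \<le> t"
    "A (ennreal t) \<le> (\<integral>\<^sup>+y. A (ennreal (f y)) * ennreal (g y powr (real n / (real n - s))) \<partial>M)"
    "(\<integral>\<^sup>+y. ennreal (f y * g y) \<partial>M) \<le> ennreal (2 * m powr (s / real n)) * young_H n s A t"
proof -
  define q where "q = real n / (real n - s)"
  define \<theta> where "\<theta> = s / real n"
  have \<theta>: "0 < \<theta>" "\<theta> < 1" using s by (auto simp: \<theta>_def)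
  have q\<theta>: "q * (1 - \<theta>) = 1" using s by (simp add: q_def \<theta>_def field_simps)
  have [measurable]: "A \<in> borel_measurable borel" by (rule young_measurable[OF A])
  let ?G = "\<integral>\<^sup>+y. A (ennreal (f y)) * ennreal (g y powr q) \<partial>M"
  define \<alpha> where "\<alpha> y = enn2real (A (ennreal (f y)))" for y
  have \<alpha>0: "0 \<le> \<alpha> y" for y by (simp add: \<alpha>_def)
  have [measurable]: "\<alpha> \<in> borel_measurable M" unfolding \<alpha>_def by measurable
  \<comment> \<open>Finiteness of the modular excludes the value \<open>\<infinity>\<close> up to a null set, so real arithmetic is available.\<close>
  have fin: "AE y in M. A (ennreal (f y)) = ennreal (\<alpha> y)"
  proof -
    have "AE y in M. A (ennreal (f y)) \<noteq> \<infinity>"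
      by (rule nn_integral_PInf_AE) (use m in \<open>auto simp: top_unique\<close>)
    then show ?thesis by eventually_elim (simp add: \<alpha>_def less_top)
  qed
  have gq: "(g y powr q) powr (1 - \<theta>) = g y" for y
    using nonneg[of y] by (simp add: powr_powr q\<theta>)
  show ?thesis
  proof (cases "?G = 0")
    \<comment> \<open>Since \<open>A > 0\<close> off \<open>0\<close>, here \<open>f g = 0\<close> almost everywhere, and \<open>t = 0\<close> serves.\<close>
    case True
    then have "AE y in M. A (ennreal (f y)) * ennreal (g y powr q) = 0"
      by (subst (asm) nn_integral_0_iff_AE) auto
    then have "AE y in M. ennreal (f y * g y) = 0"
    proof eventually_elim
      case (elim y)
      then show ?case
        using young_pos[OF A i0 s, of "f y"] nonneg[of y] by (cases "f y = 0") auto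
    qed
    then have "(\<integral>\<^sup>+y. ennreal (f y * g y) \<partial>M) = 0"
      by (subst nn_integral_0_iff_AE) auto
    then show ?thesis
      using that[of 0] A by (simp add: young_function_def)
  next
    case False
    obtain G where G: "?G = ennreal G" "0 < G"
      using Gfin False by (cases ?G) (auto simp: q_def)
    obtain t where t: "0 \<le> t" "A (ennreal t) \<le> ennreal G"
      and above: "\<And>r a. t < r \<Longrightarrow> A (ennreal r) = ennreal a \<Longrightarrow> 0 \<le> a \<Longrightarrow> G * r \<le> t * a"
      using young_level[OF A i0 s G(2)] by blast
    obtain h where h: "young_H n s A t = ennreal h" "0 \<le> h"
      using young_H_finite[OF A i0 s, of t] by (cases "young_H n s A t") auto
    obtain a where a: "A (ennreal t) = ennreal a" "0 \<le> a"
      using t by (cases "A (ennreal t)") (auto simp: top_unique)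
    have "t \<le> a powr \<theta> * h"
      using young_H_ge[OF A s i0 t(1) a] h by (simp add: \<theta>_def ennreal_mult[symmetric])
    also have "\<dots> \<le> G powr \<theta> * h"
      using t a G h \<theta> by (intro mult_right_mono powr_mono2) (auto simp: ennreal_le_iff)
    finally have tG: "t \<le> G powr \<theta> * h" .
    \<comment> \<open>One bound for both cases \<open>f y \<le> t\<close> and \<open>f y > t\<close>, shaped so that each summand is a geometric mean.\<close>
    have pt: "AE y in M. f y * g y
        \<le> h * (\<alpha> y powr \<theta> * (g y powr q) powr (1 - \<theta>))
          + (t / G) * (\<alpha> y powr \<theta> * (\<alpha> y * g y powr q) powr (1 - \<theta>))"
      using fin
    proof eventually_elim
      case (elim y)
      have r1: "(\<alpha> y * g y powr q) powr (1 - \<theta>) = \<alpha> y powr (1 - \<theta>) * g y"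
        using \<alpha>0[of y] nonneg[of y] by (simp add: powr_mult gq)
      have r2: "\<alpha> y powr \<theta> * \<alpha> y powr (1 - \<theta>) = \<alpha> y"
        using \<alpha>0[of y] by (simp add: powr_add[symmetric])
      have "f y \<le> h * \<alpha> y powr \<theta> + (t / G) * \<alpha> y"
      proof (cases "f y \<le> t")
        case True
        have "ennreal (f y) \<le> ennreal (\<alpha> y powr \<theta>) * young_H n s A (f y)"
          unfolding \<theta>_def by (rule young_H_ge[OF A s i0 nonneg(1) elim \<alpha>0])
        also have "\<dots> \<le> ennreal (\<alpha> y powr \<theta>) * ennreal h"
          unfolding h(1)[symmetric] by (intro mult_left_mono young_H_mono s True) auto
        finally have "f y \<le> \<alpha> y powr \<theta> * h"
          using h by (simp add: ennreal_mult[symmetric])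
        then show ?thesis using t G \<alpha>0[of y] by (simp add: mult.commute add_increasing2)
      next
        case False
        then have "G * f y \<le> t * \<alpha> y" using above[of "f y" "\<alpha> y"] elim \<alpha>0[of y] by simp
        then have "f y \<le> (t / G) * \<alpha> y" using G by (simp add: field_simps)
        then show ?thesis using h by (simp add: add_increasing)
      qed
      then have "f y * g y \<le> (h * \<alpha> y powr \<theta> + (t / G) * \<alpha> y) * g y"
        using nonneg[of y] by (intro mult_right_mono) auto
      also have "\<dots> = h * (\<alpha> y powr \<theta> * g y) + (t / G) * ((\<alpha> y powr \<theta> * \<alpha> y powr (1 - \<theta>)) * g y)"
        unfolding r2 by (simp add: algebra_simps)
      finally show ?case unfolding gq r1 by (simp add: mult.assoc)
    qed
    have \<alpha>m: "(\<integral>\<^sup>+y. ennreal (\<alpha> y) \<partial>M) \<le> ennreal m"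
      using m(2) nn_integral_cong_AE[OF fin] by simp
    have \<alpha>G: "(\<integral>\<^sup>+y. ennreal (\<alpha> y * g y powr q) \<partial>M) = ennreal G"
      unfolding G(1)[symmetric] using fin
      by (intro nn_integral_cong_AE) (auto simp: ennreal_mult \<alpha>0)
    have g1': "(\<integral>\<^sup>+y. ennreal (g y powr q) \<partial>M) \<le> ennreal 1"
      using g1 by (simp add: q_def)
    have I1: "(\<integral>\<^sup>+y. ennreal (\<alpha> y powr \<theta> * (g y powr q) powr (1 - \<theta>)) \<partial>M)
        \<le> ennreal (m powr \<theta> * 1 powr (1 - \<theta>))"
      using \<alpha>m g1' m(1) \<theta> \<alpha>0 by (intro nn_integral_geometric_mean_le) auto
    have I2: "(\<integral>\<^sup>+y. ennreal (\<alpha> y powr \<theta> * (\<alpha> y * g y powr q) powr (1 - \<theta>)) \<partial>M)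
        \<le> ennreal (m powr \<theta> * G powr (1 - \<theta>))"
      using \<alpha>m \<alpha>G m(1) G(2) \<theta> \<alpha>0 by (intro nn_integral_geometric_mean_le) auto
    have "(\<integral>\<^sup>+y. ennreal (f y * g y) \<partial>M)
      \<le> (\<integral>\<^sup>+y. ennreal h * ennreal (\<alpha> y powr \<theta> * (g y powr q) powr (1 - \<theta>))
          + ennreal (t / G) * ennreal (\<alpha> y powr \<theta> * (\<alpha> y * g y powr q) powr (1 - \<theta>)) \<partial>M)"
      using pt
    proof (intro nn_integral_mono_AE, eventually_elim)
      case (elim y)
      from elim show ?case
        using h(2) t(1) G(2)
        by (subst (1 2) ennreal_mult[symmetric])
           (auto simp: ennreal_plus[symmetric] simp del: ennreal_plus intro!: ennreal_leI)
    qed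
    also have "\<dots> = ennreal h * (\<integral>\<^sup>+y. ennreal (\<alpha> y powr \<theta> * (g y powr q) powr (1 - \<theta>)) \<partial>M)
      + ennreal (t / G) * (\<integral>\<^sup>+y. ennreal (\<alpha> y powr \<theta> * (\<alpha> y * g y powr q) powr (1 - \<theta>)) \<partial>M)"
      by (simp add: nn_integral_add nn_integral_cmult)
    also have "\<dots> \<le> ennreal h * ennreal (m powr \<theta> * 1 powr (1 - \<theta>))
      + ennreal (t / G) * ennreal (m powr \<theta> * G powr (1 - \<theta>))"
      by (intro add_mono mult_left_mono I1 I2) auto
    also have "\<dots> = ennreal (m powr \<theta> * (h + t * (G powr (1 - \<theta>) / G)))"
      using h(2) t(1) G(2)
      by (simp add: ennreal_mult[symmetric] ennreal_plus[symmetric] algebra_simps del: ennreal_plus)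
    also have "\<dots> \<le> ennreal (m powr \<theta> * (2 * h))"
    proof (intro ennreal_leI mult_left_mono)
      have "t * (G powr (1 - \<theta>) / G) = t / G powr \<theta>"
        using G(2) by (simp add: powr_diff)
      also have "\<dots> \<le> h" using tG G(2) by (simp add: divide_le_eq mult.commute)
      finally show "h + t * (G powr (1 - \<theta>) / G) \<le> 2 * h" by simp
    qed simp
    also have "\<dots> = ennreal (2 * m powr (s / real n)) * young_H n s A t"
      using h by (simp add: \<theta>_def ennreal_mult[symmetric] ac_simps)
    finally show ?thesis
      using that[OF t(1)] t(2) G(1) by (simp add: q_def)
  qed
qed

section \<open>The Sobolev conjugate\<close>

text \<open>
  By definition of the generalized inverse, \<open>w \<le> H(t)\<close> implies \<open>H\<^sup>-\<^sup>1(w) \<le> t\<close>.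
\<close>

lemma sobolev_young_le:
  assumes A: "young_function A" and "0 \<le> t" "w \<le> young_H n s A t"
  shows "sobolev_young n s A w \<le> A (ennreal t)"
  unfolding sobolev_young_def young_H_inv_def
  using assms by (intro monoD[OF young_mono[OF A]] INF_lower) auto

lemma sobolev_young_zero:
  assumes A: "young_function A"
  shows "sobolev_young n s A 0 = 0"
  using sobolev_young_le[OF A, of 0 0 n s] A by (simp add: young_function_def)

section \<open>Convolution and Lebesgue measure\<close>

lemma distr_lborel_reflect:
  "distr lborel borel (\<lambda>y. x - y) = (lborel :: 'a::euclidean_space measure)"
  by (subst lborel_affine[of "-1" x]) (auto simp: density_1)

lemma AE_lebesgue_reflect:
  assumes "AE y in lebesgue. P y"
  shows "AE y in lebesgue. P (x - y :: 'a::euclidean_space)"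
proof -
  have "AE y in distr lborel borel (\<lambda>y. x - y). P y"
    using assms unfolding distr_lborel_reflect AE_completion_iff .
  then have "AE y in lborel. P (x - y)"
    by (rule AE_distrD[rotated]) simp
  then show ?thesis by (simp add: AE_completion_iff)
qed

lemma lebesgue_measurable_reflect:
  "(\<lambda>y. x - y :: 'a::euclidean_space) \<in> lebesgue \<rightarrow>\<^sub>M lebesgue"
  using lebesgue_affine_measurable[of "\<lambda>_::'a. - 1" x]
  unfolding scaleR_scaleR[symmetric] scaleR_sum_right[symmetric] euclidean_representation
  by simp

lemma nn_integral_lborel_reflect:
  assumes [measurable]: "f \<in> borel_measurable borel"
  shows "(\<integral>\<^sup>+y. f (x - y :: 'a::euclidean_space) \<partial>lborel) = (\<integral>\<^sup>+y. f y \<partial>lborel)"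
  by (subst distr_lborel_reflect[of x, symmetric]) (simp add: nn_integral_distr)

lemma nn_integral_lborel_shift:
  assumes [measurable]: "f \<in> borel_measurable borel"
  shows "(\<integral>\<^sup>+x. f (x - y :: 'a::euclidean_space) \<partial>lborel) = (\<integral>\<^sup>+x. f x \<partial>lborel)"
  by (subst lborel_distr_plus[of "- y", symmetric]) (simp add: nn_integral_distr)

lemma nn_integral_convolution:
  fixes f g :: "'a::euclidean_space \<Rightarrow> ennreal"
  assumes [measurable]: "f \<in> borel_measurable borel" "g \<in> borel_measurable borel"
  shows "(\<integral>\<^sup>+x. (\<integral>\<^sup>+y. f (x - y) * g y \<partial>lborel) \<partial>lborel)
    = (\<integral>\<^sup>+x. f x \<partial>lborel) * (\<integral>\<^sup>+y. g y \<partial>lborel)"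
proof -
  have "(\<integral>\<^sup>+x. (\<integral>\<^sup>+y. f (x - y) * g y \<partial>lborel) \<partial>lborel)
      = (\<integral>\<^sup>+y. (\<integral>\<^sup>+x. f (x - y) * g y \<partial>lborel) \<partial>lborel)"
    by (rule lborel_pair.Fubini') measurable
  also have "\<dots> = (\<integral>\<^sup>+y. (\<integral>\<^sup>+x. f x \<partial>lborel) * g y \<partial>lborel)"
    by (simp add: nn_integral_multc nn_integral_lborel_shift)
  also have "\<dots> = (\<integral>\<^sup>+x. f x \<partial>lborel) * (\<integral>\<^sup>+y. g y \<partial>lborel)"
    by (simp add: nn_integral_cmult)
  finally show ?thesis .
qed

section \<open>The modular inequality\<close>

text \<open>
  Borel measurability of \<open>u\<close> and \<open>v\<close> makes \<open>(x, y) \<mapsto> u (x - y) * v y\<close> jointly measurable, as is needed for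
  Tonelli's theorem. Almost every \<open>x\<close> has \<open>G x < \<infinity>\<close> because \<open>G\<close> is integrable, and at such points the
  pointwise bound applies.
\<close>

lemma borel_convolution_modular:
  fixes u v :: "'a::euclidean_space \<Rightarrow> real"
  assumes A: "young_function A" and i0: "integral_near_0_finite n s A"
    and s: "0 < s" "s < real n"
    and uv[measurable]: "u \<in> borel_measurable borel" "v \<in> borel_measurable borel"
    and m: "0 < m" "(\<integral>\<^sup>+y. A (ennreal \<bar>u y\<bar>) \<partial>lborel) \<le> ennreal m"
    and v1: "(\<integral>\<^sup>+y. ennreal (\<bar>v y\<bar> powr (real n / (real n - s))) \<partial>lborel) \<le> 1"
  shows "AE x in lborel. integrable lborel (\<lambda>y. u (x - y) * v y)"
    and "(\<integral>\<^sup>+x. sobolev_young n s A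
        (ennreal (\<bar>\<integral>y. u (x - y) * v y \<partial>lborel\<bar> / (2 * m powr (s / real n)))) \<partial>lborel)
      \<le> (\<integral>\<^sup>+y. A (ennreal \<bar>u y\<bar>) \<partial>lborel)"
proof -
  have [measurable]: "A \<in> borel_measurable borel" by (rule young_measurable[OF A])
  define G where "G x = (\<integral>\<^sup>+y. A (ennreal \<bar>u (x - y)\<bar>) * ennreal (\<bar>v y\<bar> powr (real n / (real n - s))) \<partial>lborel)" for x
  have [measurable]: "G \<in> borel_measurable borel"
    unfolding G_def by measurable
  have IG: "(\<integral>\<^sup>+x. G x \<partial>lborel) \<le> (\<integral>\<^sup>+y. A (ennreal \<bar>u y\<bar>) \<partial>lborel)"
  proof -
    have "(\<integral>\<^sup>+x. G x \<partial>lborel) = (\<integral>\<^sup>+y. A (ennreal \<bar>u y\<bar>) \<partial>lborel)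
        * (\<integral>\<^sup>+y. ennreal (\<bar>v y\<bar> powr (real n / (real n - s))) \<partial>lborel)"
      unfolding G_def by (rule nn_integral_convolution) measurable
    also have "\<dots> \<le> (\<integral>\<^sup>+y. A (ennreal \<bar>u y\<bar>) \<partial>lborel) * 1"
      by (intro mult_left_mono v1) auto
    finally show ?thesis by simp
  qed
  have "AE x in lborel. G x \<noteq> \<infinity>"
    using IG m by (intro nn_integral_PInf_AE) (auto simp: top_unique)
  then have main: "AE x in lborel. integrable lborel (\<lambda>y. u (x - y) * v y) \<and>
    sobolev_young n s A
      (ennreal (\<bar>\<integral>y. u (x - y) * v y \<partial>lborel\<bar> / (2 * m powr (s / real n)))) \<le> G x"
  proof eventually_elim
    case (elim x)
    let ?c = "2 * m powr (s / real n)"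
    have mx: "(\<integral>\<^sup>+y. A (ennreal \<bar>u (x - y)\<bar>) \<partial>lborel) \<le> ennreal m"
      using m(2) nn_integral_lborel_reflect[of "\<lambda>z. A (ennreal \<bar>u z\<bar>)" x] by simp
    have Gx: "(\<integral>\<^sup>+y. A (ennreal \<bar>u (x - y)\<bar>) * ennreal (\<bar>v y\<bar> powr (real n / (real n - s))) \<partial>lborel) < \<infinity>"
      using elim by (simp add: G_def less_top)
    have meas: "(\<lambda>y. \<bar>u (x - y)\<bar>) \<in> borel_measurable lborel" "(\<lambda>y. \<bar>v y\<bar>) \<in> borel_measurable lborel"
      by measurable
    obtain t where t: "0 \<le> t" "A (ennreal t) \<le> G x"
      "(\<integral>\<^sup>+y. ennreal (\<bar>u (x - y)\<bar> * \<bar>v y\<bar>) \<partial>lborel) \<le> ennreal ?c * young_H n s A t"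
      using integral_product_le_young_H[OF A i0 s meas abs_ge_zero abs_ge_zero m(1) mx v1 Gx]
      unfolding G_def by blast
    obtain h where h: "young_H n s A t = ennreal h" "0 \<le> h"
      using young_H_finite[OF A i0 s, of t] by (cases "young_H n s A t") auto
    have c0: "0 < ?c" using m by simp
    have le: "(\<integral>\<^sup>+y. ennreal (norm (u (x - y) * v y)) \<partial>lborel) \<le> ennreal (?c * h)"
      using t(3) h c0 by (simp add: abs_mult ennreal_mult)
    have int: "integrable lborel (\<lambda>y. u (x - y) * v y)"
      unfolding integrable_iff_bounded using le by (auto simp: top_unique less_top[symmetric])
    have "ennreal (norm (\<integral>y. u (x - y) * v y \<partial>lborel)) \<le> ennreal (?c * h)"
      using integral_norm_bound_ennreal[OF int] le by (rule order_trans)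
    then have "\<bar>\<integral>y. u (x - y) * v y \<partial>lborel\<bar> \<le> ?c * h"
      using h c0 by (simp add: ennreal_le_iff)
    then have "\<bar>\<integral>y. u (x - y) * v y \<partial>lborel\<bar> / ?c \<le> h"
      using c0 by (simp add: divide_le_eq mult.commute)
    then have "sobolev_young n s A (ennreal (\<bar>\<integral>y. u (x - y) * v y \<partial>lborel\<bar> / ?c)) \<le> A (ennreal t)"
      using t h by (intro sobolev_young_le A) (auto intro: ennreal_leI)
    with t int show ?case by auto
  qed
  then show "AE x in lborel. integrable lborel (\<lambda>y. u (x - y) * v y)"
    by eventually_elim simp
  show "(\<integral>\<^sup>+x. sobolev_young n s A
        (ennreal (\<bar>\<integral>y. u (x - y) * v y \<partial>lborel\<bar> / (2 * m powr (s / real n)))) \<partial>lborel)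
      \<le> (\<integral>\<^sup>+y. A (ennreal \<bar>u y\<bar>) \<partial>lborel)"
    using main by (intro order_trans[OF nn_integral_mono_AE IG]) auto
qed

text \<open>
  Changing \<open>u\<close> and \<open>v\<close> on null sets does not affect the convolution at any point, because reflections and
  translations preserve null sets. This reduces Lebesgue measurable functions to Borel ones.
\<close>

lemma lebesgue_convolution_borel_representatives:
  fixes u v :: "'a::euclidean_space \<Rightarrow> real"
  assumes u: "u \<in> borel_measurable lebesgue" and v: "v \<in> borel_measurable lebesgue"
  obtains u' v' where "u' \<in> borel_measurable borel" "v' \<in> borel_measurable borel"
    "AE x in lebesgue. u x = u' x" "AE x in lebesgue. v x = v' x"
    "\<And>x. integrable lborel (\<lambda>y. u' (x - y) * v' y) \<Longrightarrow> integrable lebesgue (\<lambda>y. u (x - y) * v y)"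
    "\<And>x. conv u v x = (\<integral>y. u' (x - y) * v' y \<partial>lborel)"
proof -
  obtain u' v' where [measurable]: "u' \<in> borel_measurable lborel" "v' \<in> borel_measurable lborel"
    and ae: "AE x in lborel. u x = u' x" "AE x in lborel. v x = v' x"
    using completion_ex_borel_measurable_real[OF u] completion_ex_borel_measurable_real[OF v]
    by blast
  then have ae': "AE x in lebesgue. u x = u' x" "AE x in lebesgue. v x = v' x"
    by (simp_all add: AE_completion_iff)
  have meas: "(\<lambda>y. u (x - y) * v y) \<in> borel_measurable lebesgue" for x
    using measurable_compose[OF lebesgue_measurable_reflect u] v by (rule borel_measurable_times)
  have meas': "(\<lambda>y. u' (x - y) * v' y) \<in> borel_measurable lborel" for x
    by measurable
  have eq: "AE y in lebesgue. u' (x - y) * v' y = u (x - y) * v y" for x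
    using AE_lebesgue_reflect[OF ae'(1), of x] ae'(2) by eventually_elim simp
  show ?thesis
  proof (rule that[of u' v'])
    fix x
    show "integrable lebesgue (\<lambda>y. u (x - y) * v y)"
      if "integrable lborel (\<lambda>y. u' (x - y) * v' y)"
      using that integrable_completion[OF meas'] meas eq
      by (intro integrable_cong_AE_imp[OF _ meas eq]) simp
    show "conv u v x = (\<integral>y. u' (x - y) * v' y \<partial>lborel)"
    proof -
      have "conv u v x = (\<integral>y. u' (x - y) * v' y \<partial>lebesgue)"
        unfolding conv_def using eq[of x]
        by (intro integral_cong_AE meas measurable_completion meas') (auto simp: eq_commute)
      then show ?thesis by (simp add: integral_completion[OF meas'])
    qed
  qed (use ae' in simp_all)
qed

lemma conv_measurable:
  fixes u v :: "'a::euclidean_space \<Rightarrow> real"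
  assumes "u \<in> borel_measurable lebesgue" "v \<in> borel_measurable lebesgue"
  shows "conv u v \<in> borel_measurable lebesgue"
proof -
  obtain u' v' where [measurable]: "u' \<in> borel_measurable borel" "v' \<in> borel_measurable borel"
    and eq: "\<And>x. conv u v x = (\<integral>y. u' (x - y) * v' y \<partial>lborel)"
    using lebesgue_convolution_borel_representatives[OF assms] by metis
  have "(\<lambda>x. \<integral>y. u' (x - y) * v' y \<partial>lborel) \<in> borel_measurable lborel"
    by measurable
  then have "conv u v \<in> borel_measurable lborel" by (simp add: eq[abs_def] cong: measurable_cong)
  then show ?thesis by (rule measurable_completion)
qed

lemma conv_modular_normalized:
  fixes u v :: "'a::euclidean_space \<Rightarrow> real"
  assumes A: "young_function A" and i0: "integral_near_0_finite n s A"
    and s: "0 < s" "s < real n"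
    and uv: "u \<in> borel_measurable lebesgue" "v \<in> borel_measurable lebesgue"
    and m: "0 < m" "modular A u \<le> ennreal m"
    and v1: "(\<integral>\<^sup>+y. ennreal (\<bar>v y\<bar> powr (real n / (real n - s))) \<partial>lebesgue) \<le> 1"
  shows "AE x in lebesgue. integrable lebesgue (\<lambda>y. u (x - y) * v y)"
    and "modular (sobolev_young n s A) (\<lambda>x. conv u v x / (2 * m powr (s / real n))) \<le> modular A u"
proof -
  obtain u' v' where uv': "u' \<in> borel_measurable borel" "v' \<in> borel_measurable borel"
    and ae: "AE x in lebesgue. u x = u' x" "AE x in lebesgue. v x = v' x"
    and int: "\<And>x. integrable lborel (\<lambda>y. u' (x - y) * v' y) \<Longrightarrow> integrable lebesgue (\<lambda>y. u (x - y) * v y)"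
    and eq: "\<And>x. conv u v x = (\<integral>y. u' (x - y) * v' y \<partial>lborel)"
    using lebesgue_convolution_borel_representatives[OF uv] by blast
  have "modular A u = (\<integral>\<^sup>+y. A (ennreal \<bar>u' y\<bar>) \<partial>lebesgue)"
    unfolding modular_def using ae(1) by (intro nn_integral_cong_AE) auto
  then have mu: "modular A u = (\<integral>\<^sup>+y. A (ennreal \<bar>u' y\<bar>) \<partial>lborel)"
    by (simp add: nn_integral_completion)
  have v': "(\<integral>\<^sup>+y. ennreal (\<bar>v' y\<bar> powr (real n / (real n - s))) \<partial>lborel) \<le> 1"
  proof -
    have "(\<integral>\<^sup>+y. ennreal (\<bar>v y\<bar> powr (real n / (real n - s))) \<partial>lebesgue)
       = (\<integral>\<^sup>+y. ennreal (\<bar>v' y\<bar> powr (real n / (real n - s))) \<partial>lebesgue)"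
      using ae(2) by (intro nn_integral_cong_AE) auto
    with v1 show ?thesis by (simp add: nn_integral_completion)
  qed
  note b = borel_convolution_modular[OF A i0 s uv' m(1) m(2)[unfolded mu] v']
  show "AE x in lebesgue. integrable lebesgue (\<lambda>y. u (x - y) * v y)"
    unfolding AE_completion_iff using b(1) by eventually_elim (rule int)
  show "modular (sobolev_young n s A) (\<lambda>x. conv u v x / (2 * m powr (s / real n))) \<le> modular A u"
    using b(2) m(1) unfolding mu unfolding modular_def eq nn_integral_completion
    by (simp add: abs_divide abs_mult)
qed

lemma Lp_norm_normalize:
  assumes v: "v \<in> borel_measurable lebesgue" and p: "0 < p" and N: "0 < N" "Lp_norm p v \<le> ennreal N"
  shows "(\<integral>\<^sup>+x. ennreal (\<bar>v x / N\<bar> powr p) \<partial>lebesgue) \<le> 1"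
proof -
  obtain i where i: "0 \<le> i" "(\<integral>\<^sup>+x. ennreal (\<bar>v x\<bar> powr p) \<partial>lebesgue) = ennreal i"
    using N(2) unfolding Lp_norm_def ennpowr_def
    by (cases "\<integral>\<^sup>+x. ennreal (\<bar>v x\<bar> powr p) \<partial>lebesgue") (auto simp: top_unique)
  have "i powr (1 / p) \<le> N"
    using N i by (simp add: Lp_norm_def ennpowr_ennreal ennreal_le_iff)
  then have "(i powr (1 / p)) powr p \<le> N powr p"
    using p by (intro powr_mono2) auto
  then have iN: "i \<le> N powr p" using p i by (simp add: powr_powr)
  have "(\<integral>\<^sup>+x. ennreal (\<bar>v x / N\<bar> powr p) \<partial>lebesgue)
      = (\<integral>\<^sup>+x. ennreal (1 / N powr p) * ennreal (\<bar>v x\<bar> powr p) \<partial>lebesgue)"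
    using N by (intro nn_integral_cong) (simp add: ennreal_mult[symmetric] powr_divide)
  also have "\<dots> = ennreal (1 / N powr p) * ennreal i"
    unfolding i(2)[symmetric] using v by (intro nn_integral_cmult) measurable
  also have "\<dots> \<le> 1" using N iN i by (simp add: ennreal_mult[symmetric])
  finally show ?thesis .
qed

text \<open>
  Both inequalities of the theorem are instances: \<open>l = 1\<close> with \<open>m = \<integral> A(\<bar>u\<bar>)\<close> for the modular one, and
  \<open>m = 1\<close> with \<open>l\<close> admissible in the Luxemburg norm of \<open>u\<close> for the other.
\<close>

lemma conv_modular_scaled:
  fixes u v :: "'a::euclidean_space \<Rightarrow> real"
  assumes A: "young_function A" and i0: "integral_near_0_finite n s A"
    and s: "0 < s" "s < real n"
    and uv: "u \<in> borel_measurable lebesgue" "v \<in> borel_measurable lebesgue"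
    and l: "0 < l" and m: "0 < m" "modular A (\<lambda>x. u x / l) \<le> ennreal m"
    and N: "0 < N" "Lp_norm (real n / (real n - s)) v \<le> ennreal N"
  shows "AE x in lebesgue. integrable lebesgue (\<lambda>y. u (x - y) * v y)"
    and "modular (sobolev_young n s A) (\<lambda>x. conv u v x / (2 * N * m powr (s / real n) * l))
      \<le> modular A (\<lambda>x. u x / l)"
proof -
  have q: "0 < real n / (real n - s)" using s by simp
  have "(\<lambda>x. u x / l) \<in> borel_measurable lebesgue" "(\<lambda>x. v x / N) \<in> borel_measurable lebesgue"
    using uv by measurable
  note b = conv_modular_normalized[OF A i0 s this m Lp_norm_normalize[OF uv(2) q N]]
  have scale: "(\<lambda>y. u (x - y) / l * (v y / N)) = (\<lambda>y. (1 / (l * N)) * (u (x - y) * v y))" for x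
    by (simp add: fun_eq_iff)
  have nz: "1 / (l * N) \<noteq> 0" using l N by simp
  show "AE x in lebesgue. integrable lebesgue (\<lambda>y. u (x - y) * v y)"
    using b(1) nz unfolding scale by (simp only: integrable_mult_left_iff) simp
  have cv: "conv (\<lambda>x. u x / l) (\<lambda>x. v x / N) x = conv u v x / (l * N)" for x
    unfolding conv_def scale by simp
  show "modular (sobolev_young n s A) (\<lambda>x. conv u v x / (2 * N * m powr (s / real n) * l))
      \<le> modular A (\<lambda>x. u x / l)"
    using b(2) unfolding cv by (simp add: ac_simps)
qed

section \<open>Orlicz and Lebesgue norms\<close>

lemma conv_eq_zero:
  fixes u v :: "'a::euclidean_space \<Rightarrow> real"
  assumes "(AE y in lebesgue. u y = 0) \<or> (AE y in lebesgue. v y = 0)"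
  shows "conv u v x = 0"
proof -
  have "AE y in lebesgue. u (x - y) * v y = 0"
    using assms
  proof
    assume "AE y in lebesgue. u y = 0"
    from AE_lebesgue_reflect[OF this, of x] show ?thesis by eventually_elim simp
  next
    assume "AE y in lebesgue. v y = 0"
    then show ?thesis by eventually_elim simp
  qed
  then show ?thesis unfolding conv_def by (rule integral_eq_zero_AE)
qed

lemma modular_eq_0_imp_AE:
  assumes A: "young_function A" and i0: "integral_near_0_finite n s A"
    and s: "0 < s" "s < real n" and u: "u \<in> borel_measurable lebesgue"
    and z: "modular A u = 0"
  shows "AE x in lebesgue. u x = 0"
proof -
  have [measurable]: "A \<in> borel_measurable borel" by (rule young_measurable[OF A])
  note [measurable] = u
  have "AE x in lebesgue. A (ennreal \<bar>u x\<bar>) = 0"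
    using z unfolding modular_def by (subst (asm) nn_integral_0_iff_AE) auto
  then show ?thesis
  proof eventually_elim
    case (elim x)
    then show ?case using young_pos[OF A i0 s, of "\<bar>u x\<bar>"] by (cases "u x = 0") auto
  qed
qed

lemma Lp_norm_eq_0_imp_AE:
  assumes v: "v \<in> borel_measurable lebesgue" and z: "Lp_norm p v = 0"
  shows "AE x in lebesgue. v x = 0"
proof -
  note [measurable] = v
  have "(\<integral>\<^sup>+x. ennreal (\<bar>v x\<bar> powr p) \<partial>lebesgue) = 0"
    using z unfolding Lp_norm_def ennpowr_def
    by (cases "\<integral>\<^sup>+x. ennreal (\<bar>v x\<bar> powr p) \<partial>lebesgue") (auto split: if_splits)
  then have "AE x in lebesgue. ennreal (\<bar>v x\<bar> powr p) = 0"
    by (subst (asm) nn_integral_0_iff_AE) auto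
  then show ?thesis by eventually_elim (auto simp: ennreal_eq_0_iff)
qed

text \<open>
  The upper bounds \<open>V + e\<close> and \<open>U + e\<close> of the two norms are positive, so the limit \<open>e \<rightarrow> 0\<close> also covers
  the cases in which one of the norms is \<open>0\<close>.
\<close>

lemma luxemburg_norm_conv_le:
  fixes u v :: "'a::euclidean_space \<Rightarrow> real"
  assumes A: "young_function A" and i0: "integral_near_0_finite n s A"
    and s: "0 < s" "s < real n"
    and u: "u \<in> orlicz_space A" and v: "v \<in> Lp_space (real n / (real n - s))"
  shows "luxemburg_norm (sobolev_young n s A) (conv u v)
    \<le> ennreal 2 * Lp_norm (real n / (real n - s)) v * luxemburg_norm A u"
proof -
  have meas: "u \<in> borel_measurable lebesgue" "v \<in> borel_measurable lebesgue"
    using u v by (simp_all add: orlicz_space_def Lp_space_def)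
  obtain U where U: "0 \<le> U" "luxemburg_norm A u = ennreal U"
    using u by (cases "luxemburg_norm A u") (auto simp: orlicz_space_def)
  obtain V where V: "0 \<le> V" "Lp_norm (real n / (real n - s)) v = ennreal V"
    using v by (cases "Lp_norm (real n / (real n - s)) v") (auto simp: Lp_space_def)
  let ?L = "luxemburg_norm (sobolev_young n s A) (conv u v)"
  have le: "?L \<le> ennreal (2 * (V + e) * (U + e))" if e: "0 < e" for e
  proof -
    have "luxemburg_norm A u < ennreal (U + e)"
      using U e by (simp add: ennreal_less_iff)
    then obtain l where l: "0 < l" "modular A (\<lambda>x. u x / l) \<le> 1" "ennreal l < ennreal (U + e)"
      unfolding luxemburg_norm_def INF_less_iff by blast
    have "modular (sobolev_young n s A) (\<lambda>x. conv u v x / (2 * (V + e) * 1 powr (s / real n) * l))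
        \<le> modular A (\<lambda>x. u x / l)"
      using l V e by (intro conv_modular_scaled(2) A i0 s meas) auto
    also have "\<dots> \<le> 1" by fact
    finally have "modular (sobolev_young n s A) (\<lambda>x. conv u v x / (2 * (V + e) * l)) \<le> 1"
      by simp
    then have "?L \<le> ennreal (2 * (V + e) * l)"
      unfolding luxemburg_norm_def using l V e by (intro INF_lower) auto
    also have "\<dots> \<le> ennreal (2 * (V + e) * (U + e))"
      using l(1,3) V e by (intro ennreal_leI mult_left_mono) (auto simp: ennreal_less_iff)
    finally show ?thesis .
  qed
  obtain L where L: "0 \<le> L" "?L = ennreal L"
    using le[of 1] by (cases ?L) (auto simp: top_unique)
  have "((\<lambda>e. 2 * (V + e) * (U + e)) \<longlongrightarrow> 2 * (V + 0) * (U + 0)) (at_right 0)"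
    by (intro tendsto_intros)
  moreover have "\<forall>\<^sub>F e in at_right 0. L \<le> 2 * (V + e) * (U + e)"
    using eventually_at_right_less
  proof eventually_elim
    case (elim e)
    then show ?case using le[of e] L U V by (simp add: ennreal_le_iff)
  qed
  ultimately have "L \<le> 2 * (V + 0) * (U + 0)"
    by (rule tendsto_lowerbound) simp
  then show ?thesis
    using L U V by (simp add: ennreal_mult[symmetric] flip: ennreal_numeral)
qed

text \<open>
  When \<open>u = 0\<close> or \<open>v = 0\<close> almost everywhere, the convolution vanishes identically and the quotient is
  \<open>0 / 0 = 0\<close>.
\<close>

lemma modular_conv_le:
  fixes u v :: "'a::euclidean_space \<Rightarrow> real"
  assumes A: "young_function A" and i0: "integral_near_0_finite n s A"
    and s: "0 < s" "s < real n"
    and u: "u \<in> orlicz_space A" and v: "v \<in> Lp_space (real n / (real n - s))"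
  shows "(\<integral>\<^sup>+x. sobolev_young n s A (ennreal \<bar>conv u v x\<bar> /
        (ennreal 2 * Lp_norm (real n / (real n - s)) v * ennpowr (modular A u) (s / real n))) \<partial>lebesgue)
    \<le> modular A u"
proof -
  have meas: "u \<in> borel_measurable lebesgue" "v \<in> borel_measurable lebesgue"
    using u v by (simp_all add: orlicz_space_def Lp_space_def)
  obtain V where V: "0 \<le> V" "Lp_norm (real n / (real n - s)) v = ennreal V"
    using v by (cases "Lp_norm (real n / (real n - s)) v") (auto simp: Lp_space_def)
  consider "modular A u = \<infinity>" | "modular A u = 0 \<or> V = 0"
    | m where "0 < m" "modular A u = ennreal m" "0 < V"
  proof (cases "modular A u")
    case (real m)
    show ?thesis
    proof (cases "m = 0 \<or> V = 0")
      case True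
      then show ?thesis using real that(2) by auto
    next
      case False
      then show ?thesis using real V(1) by (intro that(3)[of m]) simp_all
    qed
  next
    case top
    then show ?thesis using that(1) by simp
  qed
  then show ?thesis
  proof cases
    case 1
    then show ?thesis by simp
  next
    case 2
    then have "(AE y in lebesgue. u y = 0) \<or> (AE y in lebesgue. v y = 0)"
      using modular_eq_0_imp_AE[OF A i0 s meas(1)] Lp_norm_eq_0_imp_AE[OF meas(2), of "real n / (real n - s)"] V by auto
    then show ?thesis
      by (simp add: conv_eq_zero sobolev_young_zero[OF A])
  next
    case 3
    have "ennreal \<bar>conv u v x\<bar> / (ennreal 2 * ennreal V * ennpowr (ennreal m) (s / real n))
        = ennreal \<bar>conv u v x / (2 * V * m powr (s / real n) * 1)\<bar>" for x
    proof -
      have "ennreal 2 * ennreal V * ennpowr (ennreal m) (s / real n) = ennreal (2 * V * m powr (s / real n))"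
        using 3 by (simp add: ennpowr_ennreal ennreal_mult)
      then show ?thesis using 3 by (simp add: divide_ennreal abs_mult)
    qed
    moreover have "modular (sobolev_young n s A) (\<lambda>x. conv u v x / (2 * V * m powr (s / real n) * 1))
        \<le> modular A (\<lambda>x. u x / 1)"
      using 3 V by (intro conv_modular_scaled(2) A i0 s meas) auto
    ultimately show ?thesis
      using 3 V unfolding modular_def by simp
  qed
qed

lemma conv_integrable_AE:
  fixes u v :: "'a::euclidean_space \<Rightarrow> real"
  assumes A: "young_function A" and i0: "integral_near_0_finite n s A"
    and s: "0 < s" "s < real n"
    and u: "u \<in> orlicz_space A" and v: "v \<in> Lp_space (real n / (real n - s))"
  shows "AE x in lebesgue. integrable lebesgue (\<lambda>y. u (x - y) * v y)"
proof -
  have meas: "u \<in> borel_measurable lebesgue" "v \<in> borel_measurable lebesgue"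
    using u v by (simp_all add: orlicz_space_def Lp_space_def)
  obtain l where l: "0 < l" "modular A (\<lambda>x. u x / l) \<le> 1"
    using u unfolding orlicz_space_def luxemburg_norm_def by (auto simp: INF_less_iff)
  obtain V where V: "0 \<le> V" "Lp_norm (real n / (real n - s)) v = ennreal V"
    using v by (cases "Lp_norm (real n / (real n - s)) v") (auto simp: Lp_space_def)
  show ?thesis
    using l V by (intro conv_modular_scaled(1)[OF A i0 s meas, of l 1 "V + 1"]) auto
qed

theorem theorem4p3:
  fixes s :: real
  assumes "0 < s" and "s < real CARD('n::finite)"
  shows "\<exists>c::real. 0 < c \<and>
    (\<forall>A. young_function A \<longrightarrow> integral_near_0_finite CARD('n) s A \<longrightarrow>
      (\<forall>(u :: real^'n \<Rightarrow> real) (v :: real^'n \<Rightarrow> real).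
        u \<in> orlicz_space A \<longrightarrow> v \<in> Lp_space (CARD('n) / (CARD('n) - s)) \<longrightarrow>
          (AE x in lebesgue. integrable lebesgue (\<lambda>y. u (x - y) * v y)) \<and>
          conv u v \<in> orlicz_space (sobolev_young CARD('n) s A) \<and>
          luxemburg_norm (sobolev_young CARD('n) s A) (conv u v)
            \<le> ennreal c * Lp_norm (CARD('n) / (CARD('n) - s)) v * luxemburg_norm A u \<and>
          (\<integral>\<^sup>+x. sobolev_young CARD('n) s A
              (ennreal \<bar>conv u v x\<bar> /
                (ennreal c * Lp_norm (CARD('n) / (CARD('n) - s)) v
                  * ennpowr (modular A u) (s / CARD('n)))) \<partial>lebesgue)
            \<le> modular A u))"
proof (intro exI[of _ 2] conjI allI impI)
  fix A and u v :: "real^'n \<Rightarrow> real"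
  assume A: "young_function A" and i0: "integral_near_0_finite CARD('n) s A"
    and u: "u \<in> orlicz_space A" and v: "v \<in> Lp_space (CARD('n) / (CARD('n) - s))"
  note hyps = A i0 assms u v
  show "AE x in lebesgue. integrable lebesgue (\<lambda>y. u (x - y) * v y)"
    by (rule conv_integrable_AE[OF hyps])
  show norm: "luxemburg_norm (sobolev_young CARD('n) s A) (conv u v)
      \<le> ennreal 2 * Lp_norm (CARD('n) / (CARD('n) - s)) v * luxemburg_norm A u"
    by (rule luxemburg_norm_conv_le[OF hyps])
  also have "\<dots> < \<infinity>"
    using u v by (auto simp: orlicz_space_def Lp_space_def intro!: ennreal_mult_less_top[THEN iffD2])
  finally show "conv u v \<in> orlicz_space (sobolev_young CARD('n) s A)"
    using u v by (simp add: orlicz_space_def Lp_space_def conv_measurable)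
  show "(\<integral>\<^sup>+x. sobolev_young CARD('n) s A
              (ennreal \<bar>conv u v x\<bar> /
                (ennreal 2 * Lp_norm (CARD('n) / (CARD('n) - s)) v
                  * ennpowr (modular A u) (s / CARD('n)))) \<partial>lebesgue)
            \<le> modular A u"
    by (rule modular_conv_le[OF hyps])
qed simp

end
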